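(* Let $\mathbb{F}$ be a finite field of order $q$, $\theta$ a non-trivial additive character of $\mathbb{F}$, $n\ge0$ an integer, and $t$ a variable. Let $\varPhi_n$ be the canonical matrix of the pair $(\mathbb{F}^n,(\mathbb{F}^\times)^n\rtimes\mathfrak{S}_n)$. Then $$\sum_{r=0}^n\varPhi_n(s,r)\,t^r=(1-t)^s\,(1+(q-1)t)^{n-s}\qquad(0\le s\le n).$$
   Context: For $a\in\mathbb{F}^n$ let $\operatorname{wt}a$ be the number of non-zero coordinates of $a$ and let $\langle a|b\rangle=\sum_ja_jb_j$. The canonical matrix is $$\varPhi_n(s,r)=\sum_{b\in\mathbb{F}^n,\ \operatorname{wt}b=r}\overline{\theta(\langle a|b\rangle)},\qquad a\in\mathbb{F}^n\text{ any element with }\operatorname{wt}a=s$$ (independent of the choice of $a$). *)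

theory Defs
  imports
    Complex_Main
    "HOL-Library.Cardinality"
    "HOL-Computational_Algebra.Polynomial"
    "Jordan_Normal_Form.Matrix"
begin

definition additive_character :: "('a::field \<Rightarrow> complex) \<Rightarrow> bool" where
  "additive_character \<theta> \<longleftrightarrow> (\<forall>x y. \<theta> (x + y) = \<theta> x * \<theta> y) \<and> (\<forall>x. \<theta> x \<noteq> 0)"

definition wt :: "'a::zero vec \<Rightarrow> nat" where
  "wt a = card {j. j < dim_vec a \<and> a $ j \<noteq> 0}"

definition weight_sum :: "('a::field \<Rightarrow> complex) \<Rightarrow> nat \<Rightarrow> 'a vec \<Rightarrow> nat \<Rightarrow> complex" where
  "weight_sum \<theta> n a r = (\<Sum>b | b \<in> carrier_vec n \<and> wt b = r. cnj (\<theta> (a \<bullet> b)))"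

text \<open>The orbits of the monomial group on \<open>F\<^sup>n\<close> are the sets of vectors of a given weight, so
  the entries are indexed by weights. The choice of the row representative does not matter, by
  \<open>canonical_matrix_eq\<close> below; for \<open>s > n\<close> there is no representative and the value is
  meaningless.\<close>

definition canonical_matrix :: "('a::field \<Rightarrow> complex) \<Rightarrow> nat \<Rightarrow> nat \<Rightarrow> nat \<Rightarrow> complex" where
  "canonical_matrix \<theta> n s r = weight_sum \<theta> n (SOME a. a \<in> carrier_vec n \<and> wt a = s) r"

lemma finite_carrier_vec: "finite (carrier_vec n :: 'a::finite vec set)"
proof -
  have "(carrier_vec n :: 'a vec set) \<subseteq> vec_of_list ` {xs. set xs \<subseteq> UNIV \<and> length xs = n}"
  proof
    fix v :: "'a vec"
    assume "v \<in> carrier_vec n"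
    then have "v = vec_of_list (list_of_vec v)" "length (list_of_vec v) = n"
      by (simp_all add: vec_list)
    then show "v \<in> vec_of_list ` {xs. set xs \<subseteq> UNIV \<and> length xs = n}"
      by blast
  qed
  then show ?thesis
    by (rule finite_subset) (intro finite_imageI finite_lists_length_eq finite)
qed

lemma exists_weight:
  assumes "s \<le> n"
  shows "\<exists>a :: 'a::zero_neq_one vec. a \<in> carrier_vec n \<and> wt a = s"
proof -
  define v :: "'a vec" where "v = vec n (\<lambda>j. if j < s then 1 else 0)"
  have "{j. j < dim_vec v \<and> v $ j \<noteq> 0} = {..<s}"
    using assms by (auto simp: v_def split: if_splits)
  then have "v \<in> carrier_vec n \<and> wt v = s"
    by (simp add: wt_def v_def)
  then show ?thesis ..
qed

lemma weight_sum_cong: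
  fixes a a' :: "'a::{field,finite} vec"
  assumes a: "a \<in> carrier_vec n" and a': "a' \<in> carrier_vec n" and eq: "wt a = wt a'"
  shows "weight_sum \<theta> n a r = weight_sum \<theta> n a' r"
proof -
  define S where "S = {j. j < n \<and> a $ j \<noteq> 0}"
  define S' where "S' = {j. j < n \<and> a' $ j \<noteq> 0}"
  have fin: "finite S" "finite S'" and sub: "S \<subseteq> {..<n}" "S' \<subseteq> {..<n}"
    by (auto simp: S_def S'_def)
  have card_eq: "card S = card S'"
    using a a' eq by (simp add: wt_def S_def S'_def)
  then have "card ({..<n} - S) = card ({..<n} - S')"
    using sub fin by (simp add: card_Diff_subset)
  then obtain f g where f: "bij_betw f S S'" and g: "bij_betw g ({..<n} - S) ({..<n} - S')"
    using finite_same_card_bij[OF fin card_eq]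
      finite_same_card_bij[of "{..<n} - S" "{..<n} - S'"] by auto
  define p where "p = (\<lambda>i. if i \<in> S then f i else g i)"
  have pS: "bij_betw p S S'"
    using f bij_betw_cong[of S p f] by (simp add: p_def)
  have pN: "bij_betw p ({..<n} - S) ({..<n} - S')"
    using g bij_betw_cong[of "{..<n} - S" p g] by (simp add: p_def)
  have p: "bij_betw p {..<n} {..<n}"
    using bij_betw_combine[OF pS pN] sub by (simp add: Un_absorb1)
  have p_less: "p i < n" if "i < n" for i
    using p that by (auto dest: bij_betwE)
  define u where "u = (\<lambda>i. if i \<in> S then a' $ p i / a $ i else 1)"
  have u: "u i \<noteq> 0" if "i < n" for i
    using that bij_betwE[OF pS] by (auto simp: u_def S_def S'_def)
  have au: "a $ i * u i = a' $ p i" if "i < n" for i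
    using that bij_betwE[OF pN] p_less[OF that] by (cases "i \<in> S") (auto simp: u_def S_def S'_def)
  define h where "h b = vec n (\<lambda>i. u i * b $ p i)" for b
  have h_carrier: "h b \<in> carrier_vec n" for b
    by (simp add: h_def)
  have inj: "inj_on h (carrier_vec n)"
  proof (rule inj_onI)
    fix b c
    assume bc: "b \<in> carrier_vec n" "c \<in> carrier_vec n" and heq: "h b = h c"
    have "b $ j = c $ j" if j: "j < n" for j
    proof -
      obtain i where i: "i < n" "p i = j"
        using p j by (metis bij_betw_iff_bijections lessThan_iff)
      have "h b $ i = h c $ i"
        by (simp add: heq)
      then show ?thesis
        using i u[OF i(1)] by (simp add: h_def)
    qed
    then show "b = c"
      using bc by (intro eq_vecI) auto
  qed
  have wt_h: "wt (h b) = wt b" if b: "b \<in> carrier_vec n" for b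
  proof -
    have "inj_on p {i. i < n \<and> b $ p i \<noteq> 0}"
      using bij_betw_imp_inj_on[OF p] by (rule inj_on_subset) auto
    moreover have "p ` {i. i < n \<and> b $ p i \<noteq> 0} = {j. j < n \<and> b $ j \<noteq> 0}"
    proof (intro equalityI subsetI)
      fix j
      assume j: "j \<in> {j. j < n \<and> b $ j \<noteq> 0}"
      then have "j \<in> p ` {..<n}"
        using bij_betw_imp_surj_on[OF p] by simp
      with j show "j \<in> p ` {i. i < n \<and> b $ p i \<noteq> 0}"
        by blast
    qed (use p_less in blast)
    ultimately have "bij_betw p {i. i < n \<and> b $ p i \<noteq> 0} {j. j < n \<and> b $ j \<noteq> 0}"
      by (rule bij_betw_imageI)
    moreover have "{i. i < n \<and> h b $ i \<noteq> 0} = {i. i < n \<and> b $ p i \<noteq> 0}"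
      using u by (auto simp: h_def)
    ultimately show ?thesis
      using b by (auto simp: wt_def h_def dest: bij_betw_same_card)
  qed
  have prod_h: "a \<bullet> h b = a' \<bullet> b" if b: "b \<in> carrier_vec n" for b
  proof -
    have "a \<bullet> h b = (\<Sum>i<n. a' $ p i * b $ p i)"
      by (simp add: scalar_prod_def h_def lessThan_atLeast0 au flip: mult.assoc)
    also have "\<dots> = (\<Sum>j<n. a' $ j * b $ j)"
      by (rule sum.reindex_bij_betw[OF p])
    also have "\<dots> = a' \<bullet> b"
      using b by (simp add: scalar_prod_def lessThan_atLeast0)
    finally show ?thesis .
  qed
  have "bij_betw h {b. b \<in> carrier_vec n \<and> wt b = r} {b. b \<in> carrier_vec n \<and> wt b = r}"
  proof -
    have "h ` {b. b \<in> carrier_vec n \<and> wt b = r} = {b. b \<in> carrier_vec n \<and> wt b = r}"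
    proof (intro endo_inj_surj)
      show "finite {b :: 'a vec. b \<in> carrier_vec n \<and> wt b = r}"
        using finite_carrier_vec by (rule rev_finite_subset) auto
      show "inj_on h {b. b \<in> carrier_vec n \<and> wt b = r}"
        using inj by (rule inj_on_subset) auto
    qed (use h_carrier wt_h in auto)
    then show ?thesis
      using inj by (auto simp: bij_betw_def intro: inj_on_subset)
  qed
  then have "weight_sum \<theta> n a r = (\<Sum>b | b \<in> carrier_vec n \<and> wt b = r. cnj (\<theta> (a \<bullet> h b)))"
    unfolding weight_sum_def by (rule sum.reindex_bij_betw[symmetric])
  also have "\<dots> = weight_sum \<theta> n a' r"
    unfolding weight_sum_def by (intro sum.cong) (auto simp: prod_h)
  finally show ?thesis .
qed

lemma canonical_matrix_eq:
  fixes a :: "'a::{field,finite} vec"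
  assumes "a \<in> carrier_vec n" and "wt a = s"
  shows "canonical_matrix \<theta> n s r = (\<Sum>b | b \<in> carrier_vec n \<and> wt b = r. cnj (\<theta> (a \<bullet> b)))"
proof -
  define a' :: "'a vec" where "a' = (SOME a. a \<in> carrier_vec n \<and> wt a = s)"
  have "a' \<in> carrier_vec n \<and> wt a' = s"
    unfolding a'_def by (rule someI[of _ a]) (use assms in simp)
  then have "weight_sum \<theta> n a' r = weight_sum \<theta> n a r"
    using assms by (intro weight_sum_cong) auto
  then show ?thesis
    by (simp only: canonical_matrix_def weight_sum_def a'_def)
qed

end

theory Submission
  imports Defs
begin

text \<open>Grouping the \<open>b \<in> F\<^sup>n\<close> by weight, the left-hand side is the sum over all \<open>b\<close> of
  \<open>cnj (\<theta> (a \<bullet> b)) t ^ wt b\<close>. Both \<open>\<theta> (a \<bullet> b)\<close> and \<open>t ^ wt b\<close> are products over the coordinates,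
  so the sum is the product over \<open>j < n\<close> of the sums for \<open>n = 1\<close>. Such a factor is
  \<open>1 + (q - 1) t\<close> if \<open>a\<^sub>j = 0\<close>, and \<open>1 - t\<close> otherwise, since a non-trivial character sums to 0.\<close>

lemma additive_character_add: "additive_character \<theta> \<Longrightarrow> \<theta> (x + y) = \<theta> x * \<theta> y"
  by (simp add: additive_character_def)

lemma additive_character_0:
  assumes "additive_character \<theta>"
  shows "\<theta> 0 = 1"
  using assms additive_character_add[OF assms, of 0 0] by (auto simp: additive_character_def)

lemma additive_character_sum:
  assumes "additive_character \<theta>"
  shows "\<theta> (\<Sum>i\<in>A. f i) = (\<Prod>i\<in>A. \<theta> (f i))"
  by (induction A rule: infinite_finite_induct)
    (simp_all add: assms additive_character_0 additive_character_add)

text \<open>Translation by some \<open>y\<close> with \<open>\<theta> y \<noteq> 1\<close> permutes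
  the field and multiplies the sum by \<open>\<theta> y\<close>, which forces it to vanish.\<close>

lemma sum_additive_character:
  fixes \<theta> :: "'a::{field,finite} \<Rightarrow> complex"
  assumes char: "additive_character \<theta>" and nontriv: "\<theta> \<noteq> (\<lambda>_. 1)"
  shows "(\<Sum>x\<in>UNIV. \<theta> x) = 0"
proof -
  obtain y where y: "\<theta> y \<noteq> 1"
    using nontriv by blast
  have "bij_betw (\<lambda>x. y + x) UNIV UNIV"
    by (rule bij_betw_byWitness[where f' = "\<lambda>x. x - y"]) auto
  then have "(\<Sum>x\<in>UNIV. \<theta> x) = (\<Sum>x\<in>UNIV. \<theta> (y + x))"
    by (rule sum.reindex_bij_betw[symmetric])
  also have "\<dots> = \<theta> y * (\<Sum>x\<in>UNIV. \<theta> x)"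
    by (simp add: char additive_character_add sum_distrib_left)
  finally show ?thesis
    using y by (simp add: mult_cancel_right1)
qed

lemma sum_additive_character_mult:
  fixes \<theta> :: "'a::{field,finite} \<Rightarrow> complex"
  assumes "additive_character \<theta>" and "\<theta> \<noteq> (\<lambda>_. 1)" and "c \<noteq> 0"
  shows "(\<Sum>x\<in>UNIV. \<theta> (c * x)) = 0"
proof -
  have "bij_betw (\<lambda>x. c * x) UNIV UNIV"
    using assms(3) by (intro bij_betw_byWitness[where f' = "\<lambda>x. x / c"]) auto
  then have "(\<Sum>x\<in>UNIV. \<theta> (c * x)) = (\<Sum>x\<in>UNIV. \<theta> x)"
    by (rule sum.reindex_bij_betw)
  then show ?thesis
    by (simp add: sum_additive_character assms)
qed

lemma prod_monom:
  fixes c :: "'i \<Rightarrow> 'b::comm_semiring_1"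
  shows "(\<Prod>i\<in>A. monom (c i) (k i)) = monom (\<Prod>i\<in>A. c i) (\<Sum>i\<in>A. k i)"
  by (induction A rule: infinite_finite_induct) (simp_all add: mult_monom)

lemma sum_monom: "(\<Sum>i\<in>A. monom (c i) k) = monom (\<Sum>i\<in>A. c i) k"
  by (induction A rule: infinite_finite_induct) (simp_all add: add_monom)

text \<open>An additive form of the weight: with \<open>prod_monom\<close> it splits the monomial of
  degree \<open>wt b\<close> into one factor per coordinate.\<close>

lemma wt_eq_sum:
  assumes "b \<in> carrier_vec n"
  shows "wt b = (\<Sum>j<n. of_bool (b $ j \<noteq> 0))"
proof -
  have "{j. j < dim_vec b \<and> b $ j \<noteq> 0} = {..<n} \<inter> {j. b $ j \<noteq> 0}"
    using assms by auto
  then show ?thesis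
    by (simp add: wt_def of_bool_def sum.If_cases)
qed

lemma wt_le:
  assumes "b \<in> carrier_vec n"
  shows "wt b \<le> n"
  using assms card_mono[of "{..<n}" "{j. j < n \<and> b $ j \<noteq> 0}"] by (auto simp: wt_def)

lemma bij_betw_vec: "bij_betw (vec n) ({..<n} \<rightarrow>\<^sub>E UNIV) (carrier_vec n)"
  \<comment> \<open>Functions in \<open>PiE\<close> are \<open>undefined\<close> outside
    \<open>{..<n}\<close>, so the inverse has to restrict the coordinate function.\<close>
  by (rule bij_betw_byWitness[where f' = "\<lambda>b. restrict (($) b) {..<n}"])
    (auto simp: PiE_def extensional_def fun_eq_iff)

text \<open>Distributivity: expanding the product of sums picks one \<open>x\<close> for each
  \<open>j\<close>, and these choices are exactly the vectors \<open>b\<close>.\<close>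

lemma sum_carrier_vec_prod:
  fixes f :: "nat \<Rightarrow> 'a::finite \<Rightarrow> 'b::comm_semiring_1"
  shows "(\<Sum>b\<in>carrier_vec n. \<Prod>j<n. f j (b $ j)) = (\<Prod>j<n. \<Sum>x\<in>UNIV. f j x)"
proof -
  have "(\<Prod>j<n. \<Sum>x\<in>UNIV. f j x) = (\<Sum>g\<in>{..<n} \<rightarrow>\<^sub>E UNIV. \<Prod>j<n. f j (g j))"
    by (rule prod_sum_PiE) auto
  also have "\<dots> = (\<Sum>g\<in>{..<n} \<rightarrow>\<^sub>E UNIV. \<Prod>j<n. f j (vec n g $ j))"
    by simp
  also have "\<dots> = (\<Sum>b\<in>carrier_vec n. \<Prod>j<n. f j (b $ j))"
    by (rule sum.reindex_bij_betw[OF bij_betw_vec])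
  finally show ?thesis ..
qed

lemma coordinate_factor:
  fixes \<theta> :: "'a::{field,finite} \<Rightarrow> complex"
  assumes char: "additive_character \<theta>" and nontriv: "\<theta> \<noteq> (\<lambda>_. 1)"
  shows "(\<Sum>x\<in>UNIV. monom (cnj (\<theta> (c * x))) (of_bool (x \<noteq> 0))) =
    (if c \<noteq> 0 then [:1, -1:] else [:1, of_nat CARD('a) - 1:])"
proof -
  have split: "(\<Sum>x\<in>UNIV. f x) = f 0 + (\<Sum>x\<in>-{0}. f x)" for f :: "'a \<Rightarrow> 'b::comm_monoid_add"
    by (simp add: sum.remove[of UNIV 0] Compl_eq_Diff_UNIV)
  \<comment> \<open>Only \<open>x = 0\<close> has exponent 0; all other terms have degree 1 and
    their coefficients add up.\<close>
  have "(\<Sum>x\<in>UNIV. monom (cnj (\<theta> (c * x))) (of_bool (x \<noteq> 0))) =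
      monom 1 0 + (\<Sum>x\<in>-{0}. monom (cnj (\<theta> (c * x))) 1)"
    unfolding split by (simp add: char additive_character_0)
  also have "\<dots> = [:1, cnj (\<Sum>x\<in>-{0}. \<theta> (c * x)):]"
    unfolding sum_monom by (simp add: monom_0 monom_Suc)
  also have "(\<Sum>x\<in>-{0}. \<theta> (c * x)) = (\<Sum>x\<in>UNIV. \<theta> (c * x)) - 1"
    by (simp add: split char additive_character_0)
  \<comment> \<open>For \<open>c = 0\<close> every term is \<open>\<theta> 0 = 1\<close>. Both
    values are real, so the conjugation disappears.\<close>
  also have "(\<Sum>x\<in>UNIV. \<theta> (c * x)) = (if c \<noteq> 0 then 0 else of_nat CARD('a))"
    by (simp add: sum_additive_character_mult assms additive_character_0)
  finally show ?thesis
    by simp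
qed

theorem proposition5p1p3:
  fixes \<theta> :: "'a::{field,finite} \<Rightarrow> complex" and q n s :: nat
  assumes "q = CARD('a)"
    and "additive_character \<theta>"
    and "\<theta> \<noteq> (\<lambda>_. 1)"
    and "s \<le> n"
  shows "(\<Sum>r = 0..n. monom (canonical_matrix \<theta> n s r) r) =
    [:1, -1:] ^ s * [:1, of_nat q - 1:] ^ (n - s)"
proof -
  obtain a :: "'a vec" where a: "a \<in> carrier_vec n" "wt a = s"
    using exists_weight[OF assms(4)] by blast
  \<comment> \<open>The support of \<open>a\<close>, written as the intersection that
    \<open>prod.If_cases\<close> produces.\<close>
  define S where "S = {..<n} \<inter> {j. a $ j \<noteq> 0}"
  have "S = {j. j < dim_vec a \<and> a $ j \<noteq> 0}"
    using a by (auto simp: S_def)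
  then have card_S: "card S = s"
    using a by (simp add: wt_def)
  have "{..<n} \<inter> - {j. a $ j \<noteq> 0} = {..<n} - S"
    by (auto simp: S_def)
  moreover have "card ({..<n} - S) = n - s"
    using card_S by (subst card_Diff_subset) (auto simp: S_def)
  ultimately have card_N: "card ({..<n} \<inter> - {j. a $ j \<noteq> 0}) = n - s"
    by simp
  \<comment> \<open>Writing the exponent as \<open>wt b\<close> frees the summand of
    \<open>r\<close>, so that the weight classes can be merged; by \<open>wt_le\<close> they exhaust
    \<open>carrier_vec n\<close>.\<close>
  have "(\<Sum>r = 0..n. monom (canonical_matrix \<theta> n s r) r) =
      (\<Sum>r = 0..n. \<Sum>b | b \<in> carrier_vec n \<and> wt b = r. monom (cnj (\<theta> (a \<bullet> b))) (wt b))"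
    by (simp add: canonical_matrix_eq[OF a] flip: sum_monom)
  also have "\<dots> = (\<Sum>b\<in>carrier_vec n. monom (cnj (\<theta> (a \<bullet> b))) (wt b))"
    by (rule sum.group) (auto simp: finite_carrier_vec wt_le)
  also have "\<dots> = (\<Sum>b\<in>carrier_vec n. \<Prod>j<n. monom (cnj (\<theta> (a $ j * b $ j))) (of_bool (b $ j \<noteq> 0)))"
    by (intro sum.cong refl)
      (simp add: prod_monom wt_eq_sum scalar_prod_def lessThan_atLeast0
        additive_character_sum[OF assms(2)])
  also have "\<dots> = (\<Prod>j<n. if a $ j \<noteq> 0 then [:1, -1:] else [:1, of_nat q - 1:])"
    unfolding assms(1)
    by (subst sum_carrier_vec_prod[where f = "\<lambda>j x. monom (cnj (\<theta> (a $ j * x))) (of_bool (x \<noteq> 0))"])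
      (simp add: coordinate_factor assms)
  \<comment> \<open>The factor depends only on whether \<open>j\<close> lies in the support, which
    has \<open>s\<close> elements.\<close>
  also have "\<dots> = [:1, -1:] ^ s * [:1, of_nat q - 1:] ^ (n - s)"
    using card_S card_N by (simp add: prod.If_cases S_def)
  finally show ?thesis .
qed

end
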